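(* Let $\mathcal A$ be a $C^*$-algebra, $G$ an amenable locally compact group acting on $\mathcal A$ by $*$-automorphisms such that $g\mapsto\psi(g(x))$ is continuous for every $x\in\mathcal A$ and every bounded linear functional $\psi$ on $\mathcal A$, and let $\varphi$ be a faithful $G$-strongly quasi invariant state on $\mathcal A$ with modular automorphism group $(\sigma_t^\varphi)_{t\in\mathbb R}$. If $g\circ\sigma_t^\varphi=\sigma_t^\varphi\circ g$ for all $g\in G$ and $t\in\mathbb R$, then for every invariant mean $\eta$ on $G$, $$\sigma_t^\varphi\circ\epsilon_\eta=\epsilon_\eta\circ\sigma_t^\varphi,\quad t\in\mathbb R.$$
   Context: $\varphi$ is $G$-strongly quasi invariant if for every $g\in G$ there is a self-adjoint $x_g\in\mathcal A$ with $\varphi(g(a))=\varphi(x_ga)$ for all $a\in\mathcal A$. An invariant mean on $G$ is a state $\eta$ on the bounded continuous functions on $G$ with $\eta\{f(\hat g)\}=\eta\{f(h\hat g)\}=\eta\{f(\hat gh)\}$ for every fixed $h\in G$. For $x\in\mathcal A$, $\epsilon_\eta(x)$ is the unique element of $\mathcal A^{**}$ with $\Phi(\epsilon_\eta(x))=\eta\{\Phi(\hat g(x))\}$ for all $\Phi\in\mathcal A^*$. On $\mathcal A^{**}$, $\sigma_t^\varphi$ acts by its bitranspose, i.e. $\psi(\sigma_t^\varphi(z))=(\psi\circ\sigma_t^\varphi)(z)$ for $\psi\in\mathcal A^*$, $z\in\mathcal A^{**}$. *)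

theory Defs
  imports "HOL-Analysis.Analysis"
begin

section \<open>C*-algebras (not in the library): a real Banach algebra with a compatible
  complex scalar multiplication sc and an involution st satisfying the C*-identity\<close>

definition cstar_algebra ::
  "(complex \<Rightarrow> 'a::{real_normed_algebra,banach} \<Rightarrow> 'a) \<Rightarrow> ('a \<Rightarrow> 'a) \<Rightarrow> bool" where
  "cstar_algebra sc st \<longleftrightarrow>
     (\<forall>r x. sc (complex_of_real r) x = scaleR r x) \<and>
     (\<forall>a b x. sc a (sc b x) = sc (a * b) x) \<and>
     (\<forall>a x y. sc a (x + y) = sc a x + sc a y) \<and>
     (\<forall>a b x. sc (a + b) x = sc a x + sc b x) \<and>
     (\<forall>a x y. sc a (x * y) = sc a x * y \<and> sc a (x * y) = x * sc a y) \<and>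
     (\<forall>a x. norm (sc a x) = cmod a * norm x) \<and>
     (\<forall>x. st (st x) = x) \<and>
     (\<forall>x y. st (x + y) = st x + st y) \<and>
     (\<forall>a x. st (sc a x) = sc (cnj a) (st x)) \<and>
     (\<forall>x y. st (x * y) = st y * st x) \<and>
     (\<forall>x. norm (st x * x) = (norm x)\<^sup>2)"

definition clinear_fun :: "(complex \<Rightarrow> 'a::real_normed_vector \<Rightarrow> 'a) \<Rightarrow> ('a \<Rightarrow> complex) \<Rightarrow> bool" where
  "clinear_fun sc f \<longleftrightarrow> (\<forall>x y. f (x + y) = f x + f y) \<and> (\<forall>a x. f (sc a x) = a * f x)"

definition bounded_functional :: "(complex \<Rightarrow> 'a::real_normed_vector \<Rightarrow> 'a) \<Rightarrow> ('a \<Rightarrow> complex) \<Rightarrow> bool" where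
  "bounded_functional sc f \<longleftrightarrow> clinear_fun sc f \<and> (\<exists>K. \<forall>x. cmod (f x) \<le> K * norm x)"

text \<open>A state: positive bounded linear functional of norm one (positive elements of a
  C*-algebra are exactly those of the form st y * y).\<close>

definition is_state :: "(complex \<Rightarrow> 'a::real_normed_algebra \<Rightarrow> 'a) \<Rightarrow> ('a \<Rightarrow> 'a) \<Rightarrow> ('a \<Rightarrow> complex) \<Rightarrow> bool" where
  "is_state sc st \<phi> \<longleftrightarrow> bounded_functional sc \<phi> \<and>
     (\<forall>y. Im (\<phi> (st y * y)) = 0 \<and> Re (\<phi> (st y * y)) \<ge> 0) \<and>
     (\<forall>x. cmod (\<phi> x) \<le> norm x) \<and>
     (\<forall>e>0. \<exists>x. cmod (\<phi> x) > (1 - e) * norm x)"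

definition faithful_state :: "(complex \<Rightarrow> 'a::real_normed_algebra \<Rightarrow> 'a) \<Rightarrow> ('a \<Rightarrow> 'a) \<Rightarrow> ('a \<Rightarrow> complex) \<Rightarrow> bool" where
  "faithful_state sc st \<phi> \<longleftrightarrow> is_state sc st \<phi> \<and> (\<forall>y. \<phi> (st y * y) = 0 \<longrightarrow> y = 0)"

definition star_automorphism :: "(complex \<Rightarrow> 'a::real_normed_algebra \<Rightarrow> 'a) \<Rightarrow> ('a \<Rightarrow> 'a) \<Rightarrow> ('a \<Rightarrow> 'a) \<Rightarrow> bool" where
  "star_automorphism sc st \<alpha> \<longleftrightarrow> bij \<alpha> \<and>
     (\<forall>x y. \<alpha> (x + y) = \<alpha> x + \<alpha> y) \<and> (\<forall>a x. \<alpha> (sc a x) = sc a (\<alpha> x)) \<and>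
     (\<forall>x y. \<alpha> (x * y) = \<alpha> x * \<alpha> y) \<and> (\<forall>x. \<alpha> (st x) = st (\<alpha> x))"

text \<open>An action of the (not necessarily abelian, additively written) group 'g on A by
  *-automorphisms which is weakly continuous: g \<mapsto> psi(g(x)) continuous.\<close>

definition weakly_continuous_action ::
  "(complex \<Rightarrow> 'a::real_normed_algebra \<Rightarrow> 'a) \<Rightarrow> ('a \<Rightarrow> 'a) \<Rightarrow> ('g::topological_group_add \<Rightarrow> 'a \<Rightarrow> 'a) \<Rightarrow> bool" where
  "weakly_continuous_action sc st act \<longleftrightarrow>
     (\<forall>g. star_automorphism sc st (act g)) \<and>
     act 0 = id \<and> (\<forall>g h. act (g + h) = act g \<circ> act h) \<and>
     (\<forall>x \<psi>. bounded_functional sc \<psi> \<longrightarrow> continuous_on UNIV (\<lambda>g. \<psi> (act g x)))"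

definition strongly_quasi_invariant ::
  "(complex \<Rightarrow> 'a::real_normed_algebra \<Rightarrow> 'a) \<Rightarrow> ('a \<Rightarrow> 'a) \<Rightarrow> ('g \<Rightarrow> 'a \<Rightarrow> 'a) \<Rightarrow> ('a \<Rightarrow> complex) \<Rightarrow> bool" where
  "strongly_quasi_invariant sc st act \<phi> \<longleftrightarrow>
     (\<forall>g. \<exists>xg. st xg = xg \<and> (\<forall>a. \<phi> (act g a) = \<phi> (xg * a)))"

definition invariant_mean :: "(('g::topological_group_add \<Rightarrow>\<^sub>C complex) \<Rightarrow> complex) \<Rightarrow> bool" where
  "invariant_mean \<eta> \<longleftrightarrow>
     (\<forall>(f :: 'g \<Rightarrow>\<^sub>C complex) (g :: 'g \<Rightarrow>\<^sub>C complex). \<eta> (f + g) = \<eta> f + \<eta> g) \<and> (\<forall>c (f :: 'g \<Rightarrow>\<^sub>C complex). \<eta> (Bcontfun (\<lambda>x. c * apply_bcontfun f x)) = c * \<eta> f) \<and>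
     (\<forall>f::'g \<Rightarrow>\<^sub>C complex. (\<forall>x. Im (apply_bcontfun f x) = 0 \<and> Re (apply_bcontfun f x) \<ge> 0) \<longrightarrow> Im (\<eta> f) = 0 \<and> Re (\<eta> f) \<ge> 0) \<and>
     \<eta> (Bcontfun (\<lambda>_. 1)) = 1 \<and>
     (\<forall>(f :: 'g \<Rightarrow>\<^sub>C complex) h. \<eta> (Bcontfun (\<lambda>g. apply_bcontfun f (h + g))) = \<eta> f \<and> \<eta> (Bcontfun (\<lambda>g. apply_bcontfun f (g + h))) = \<eta> f)"

definition amenable :: "'g::topological_group_add itself \<Rightarrow> bool" where
  "amenable _ \<longleftrightarrow> (\<exists>\<eta>::('g \<Rightarrow>\<^sub>C complex) \<Rightarrow> complex. invariant_mean \<eta>)"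

text \<open>Elements of A** represented as functions on A* (= bounded functionals).
  epsilon_eta x is the element Phi \<mapsto> eta(g \<mapsto> Phi(g(x))).\<close>

definition epsilon ::
  "(('g::topological_group_add \<Rightarrow>\<^sub>C complex) \<Rightarrow> complex) \<Rightarrow> ('g \<Rightarrow> 'a \<Rightarrow> 'a) \<Rightarrow> 'a \<Rightarrow> ('a \<Rightarrow> complex) \<Rightarrow> complex" where
  "epsilon \<eta> act x = (\<lambda>\<Phi>. \<eta> (Bcontfun (\<lambda>g. \<Phi> (act g x))))"

definition bitranspose :: "('a \<Rightarrow> 'a) \<Rightarrow> (('a \<Rightarrow> complex) \<Rightarrow> complex) \<Rightarrow> ('a \<Rightarrow> complex) \<Rightarrow> complex" where
  "bitranspose \<alpha> z = (\<lambda>\<psi>. z (\<psi> \<circ> \<alpha>))"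

text \<open>Modular automorphism group of a faithful state phi, characterised (Takesaki, Thm VIII.1.2)
  as the strongly continuous one-parameter group of *-automorphisms for which phi satisfies the
  modular (KMS) condition: for all x y there is F bounded continuous on the strip
  0 \<le> Im z \<le> 1, holomorphic in its interior, with F t = phi(sigma_t x * y) and
  F (t + i) = phi(y * sigma_t x).\<close>

definition modular_group ::
  "(complex \<Rightarrow> 'a::real_normed_algebra \<Rightarrow> 'a) \<Rightarrow> ('a \<Rightarrow> 'a) \<Rightarrow> ('a \<Rightarrow> complex) \<Rightarrow> (real \<Rightarrow> 'a \<Rightarrow> 'a) \<Rightarrow> bool" where
  "modular_group sc st \<phi> \<sigma> \<longleftrightarrow>
     (\<forall>t. star_automorphism sc st (\<sigma> t)) \<and> \<sigma> 0 = id \<and> (\<forall>s t. \<sigma> (s + t) = \<sigma> s \<circ> \<sigma> t) \<and>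
     (\<forall>x. continuous_on UNIV (\<lambda>t. \<sigma> t x)) \<and>
     (\<forall>x y. \<exists>F :: complex \<Rightarrow> complex.
        continuous_on {z. 0 \<le> Im z \<and> Im z \<le> 1} F \<and>
        F holomorphic_on {z. 0 < Im z \<and> Im z < 1} \<and>
        bounded (F ` {z. 0 \<le> Im z \<and> Im z \<le> 1}) \<and>
        (\<forall>t. F (complex_of_real t) = \<phi> (\<sigma> t x * y)) \<and>
        (\<forall>t. F (complex_of_real t + \<i>) = \<phi> (y * \<sigma> t x)))"

end

theory Submission
  imports Defs
begin

lemma bitranspose_epsilon_eq_epsilon_comp:
  assumes "\<And>g. act g \<circ> \<alpha> = \<alpha> \<circ> act g"
  shows "bitranspose \<alpha> (epsilon \<eta> act x) = epsilon \<eta> act (\<alpha> x)"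
proof -
  have "act g (\<alpha> x) = \<alpha> (act g x)" for g
    using assms by (metis comp_apply)
  then show ?thesis
    by (simp add: bitranspose_def epsilon_def)
qed

text \<open>Only the commutation of the action with the modular group is used: the identity
  holds pointwise on all of A*, for any functional \<open>\<eta>\<close> on the bounded continuous functions.\<close>

theorem proposition2p15:
  fixes sc :: "complex \<Rightarrow> 'a::{real_normed_algebra,banach} \<Rightarrow> 'a"
    and st :: "'a \<Rightarrow> 'a"
    and act :: "'g::{topological_group_add,t2_space} \<Rightarrow> 'a \<Rightarrow> 'a"
    and \<phi> :: "'a \<Rightarrow> complex"
    and \<sigma> :: "real \<Rightarrow> 'a \<Rightarrow> 'a"
    and \<eta> :: "('g \<Rightarrow>\<^sub>C complex) \<Rightarrow> complex"
  assumes "cstar_algebra sc st"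
    and "locally_compact_space (euclidean :: 'g topology)"
    and "amenable TYPE('g)"
    and "weakly_continuous_action sc st act"
    and "faithful_state sc st \<phi>"
    and "strongly_quasi_invariant sc st act \<phi>"
    and "modular_group sc st \<phi> \<sigma>"
    and "\<And>g t. act g \<circ> \<sigma> t = \<sigma> t \<circ> act g"
    and "invariant_mean \<eta>"
  shows "\<forall>t x \<Phi>. bounded_functional sc \<Phi> \<longrightarrow>
           bitranspose (\<sigma> t) (epsilon \<eta> act x) \<Phi> = epsilon \<eta> act (\<sigma> t x) \<Phi>"
  using bitranspose_epsilon_eq_epsilon_comp assms(8) by metis

end
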